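(* Let $a\ge 3$ be an integer and write $q=\binom{5}{2}a+4=10a+4$. Then: (i) For every integer $n\ge 8$, $ex_\Pi(n,5,10a+4)$ is asymptotic to $\Pi_{2,2}(a,n)$ as $a\to\infty$, i.e. $\lim_{a\to\infty} ex_\Pi(n,5,10a+4)/\Pi_{2,2}(a,n)=1$. (ii) For $n=7$, $$(a-2)(a+1)^{10}a^{10}\le ex_\Pi(7,5,10a+4)<(a-1)a^{11}(a+1)^9,$$ and in particular $\lim_{a\to\infty} ex_\Pi(7,5,10a+4)/\Pi_{2,2}(a,7)=1$. (iii) For $n=6$, $ex_\Pi(6,5,10a+4)=a^9(a+1)^6>\Pi_{2,2}(a,6)$, and $$\Pi_{2,2}(a,6)=\begin{cases}(a+1)^5a^{10}, & a=3,4,\\ (a-2)(a+1)^8a^6, & a\ge 5.\end{cases}$$ (iv) For $n=5$, $ex_\Pi(5,5,10a+4)=\Pi_{2,2}(a,5)=(a+1)^4a^6$.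
   Context: A multigraph is a pair $G=(V,w)$ with $w:\binom{V}{2}\to\mathbb{Z}_{\ge 0}$; $w(xy)$ is the multiplicity of the edge $xy$. For integers $s\ge 2$, $q\ge 0$, an $(n,s,q)$-graph is an $n$-vertex multigraph in which every $s$-set $X$ of vertices satisfies $\sum_{xy\in\binom{X}{2}}w(xy)\le q$. Let $\mathcal{F}(n,s,q)$ be the set of all $(n,s,q)$-graphs on vertex set $[n]=\{1,\dots,n\}$. For a multigraph $G=(V,w)$ set $P(G)=\prod_{xy\in\binom{V}{2}}w(xy)$ and $ex_\Pi(n,s,q)=\max\{P(G):G\in\mathcal{F}(n,s,q)\}$. For integers $a,r\ge1$, $d\in[0,a-1]$ and $n\in\mathbb{N}$, $\mathcal{T}_{r,d}(a,n)$ is the set of multigraphs $G$ on $[n]$ whose vertex set can be partitioned into parts $V_0,\dots,V_{r-1}$ such that all edges inside $V_0$ have multiplicity $a-d$, all edges inside $V_i$ ($i\in[r-1]$) have multiplicity $a$, and all other edges have multiplicity $a+1$. Define $\Pi_{r,d}(a,n)=\max\{P(G):G\in\mathcal{T}_{r,d}(a,n)\}$. In particular, $\mathcal{T}_{2,2}(a,n)$ consists of the multigraphs on $[n]$ with a partition $V_0\cup V_1$ where edges inside $V_0$ have multiplicity $a-2$, edges inside $V_1$ have multiplicity $a$, and edges between $V_0$ and $V_1$ have multiplicity $a+1$. *)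

theory Defs
  imports Complex_Main "HOL-Library.FuncSet" "HOL-Library.Ramsey" "HOL-Library.Disjoint_Sets"
begin

text \<open>A multigraph on \<open>V\<close> is given by its multiplicity function on the 2-subsets of \<open>V\<close>.
  The function is extensional, so that distinct functions are distinct multigraphs.\<close>

definition multigraphs :: "'a set \<Rightarrow> ('a set \<Rightarrow> nat) set" where
  "multigraphs V = nsets V 2 \<rightarrow>\<^sub>E UNIV"

definition edge_product :: "'a set \<Rightarrow> ('a set \<Rightarrow> nat) \<Rightarrow> nat" where
  "edge_product V w = (\<Prod>e\<in>nsets V 2. w e)"

definition sq_graph :: "'a set \<Rightarrow> nat \<Rightarrow> nat \<Rightarrow> ('a set \<Rightarrow> nat) \<Rightarrow> bool" where
  "sq_graph V s q w \<longleftrightarrow>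
     w \<in> multigraphs V \<and> (\<forall>X\<in>nsets V s. (\<Sum>e\<in>nsets X 2. w e) \<le> q)"

definition nsq_graphs :: "nat \<Rightarrow> nat \<Rightarrow> nat \<Rightarrow> (nat set \<Rightarrow> nat) set" where
  "nsq_graphs n s q = {w. sq_graph {1..n} s q w}"

text \<open>For \<open>2 \<le> s \<le> n\<close> every multiplicity is at most \<open>q\<close>, so the maximum is over a finite
  nonempty set; for \<open>n < s\<close> (and \<open>n \<ge> 2\<close>) it does not exist.\<close>

definition ex_Pi :: "nat \<Rightarrow> nat \<Rightarrow> nat \<Rightarrow> nat" where
  "ex_Pi n s q = Max (edge_product {1..n} ` nsq_graphs n s q)"

text \<open>Parts of the partition may be empty. The subtraction \<open>a - d\<close> is meant for \<open>d < a\<close>.\<close>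

definition turan_graphs :: "nat \<Rightarrow> nat \<Rightarrow> nat \<Rightarrow> nat \<Rightarrow> (nat set \<Rightarrow> nat) set" where
  "turan_graphs r d a n =
     {w \<in> multigraphs {1..n}.
        \<exists>U :: nat \<Rightarrow> nat set.
          disjoint_family_on U {..<r} \<and> (\<Union>i<r. U i) = {1..n} \<and>
          (\<forall>e\<in>nsets (U 0) 2. w e = a - d) \<and>
          (\<forall>i\<in>{1..<r}. \<forall>e\<in>nsets (U i) 2. w e = a) \<and>
          (\<forall>e\<in>nsets {1..n} 2. (\<forall>i<r. \<not> e \<subseteq> U i) \<longrightarrow> w e = a + 1)}"

definition turan_Pi :: "nat \<Rightarrow> nat \<Rightarrow> nat \<Rightarrow> nat \<Rightarrow> nat" where
  "turan_Pi r d a n = Max (edge_product {1..n} ` turan_graphs r d a n)"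

end

theory Submission
  imports Defs
begin

text \<open>Averaging over the 5-sets bounds the total weight of an \<open>(n, 5, 10a + 4)\<close>-graph by
  \<open>N a + \<lfloor>2N/5\<rfloor>\<close> with \<open>N = n choose 2\<close>, and a product of \<open>N\<close> naturals with such a sum is largest
  when all factors are \<open>a\<close> or \<open>a + 1\<close>. For fixed \<open>n\<close> this upper bound and the lower bound \<open>a ^ N\<close>
  given by the Turan-type graphs have ratio tending to 1; for \<open>n = 5\<close> it is attained by a star and for
  \<open>n = 6\<close> by two disjoint triangles of heavy edges. For \<open>n = 7\<close> and total weight exactly \<open>21a + 8\<close>,
  a degree count produces an edge of multiplicity at most \<open>a - 2\<close>, which makes the product smaller
  than \<open>(a - 1) a^11 (a + 1)^9\<close>; with smaller total weight the product is at most \<open>a^14 (a + 1)^7\<close>.\<close>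

section \<open>Products of naturals with a bounded sum\<close>

text \<open>The model case is one factor \<open>b\<close>, with the surplus
  \<open>k + (a - b)\<close> spent on raising other factors from \<open>a\<close> to
  \<open>a + 1\<close>. Each raise multiplies the product by \<open>(a + 1) / a\<close>; cleared of
  denominators, this is the bound. Taking \<open>b = a\<close> gives the general estimate,
  \<open>b = a - 2\<close> the sharper one for seven vertices.\<close>

lemma prod_le_balanced:
  fixes w :: "'a \<Rightarrow> nat"
  assumes A: "finite A" "e \<in> A" and e: "w e \<le> b" "b \<le> a" and a: "a > 0"
    and sum: "sum w A \<le> card A * a + k"
  shows "prod w A * a ^ (k + (a - b)) \<le> b * a ^ (card A - 1) * (a + 1) ^ (k + (a - b))"
proof -
  \<comment> \<open>With this \<open>r\<close> the discrete function \<open>h x = x r ^ x\<close> increases up to \<open>x = a\<close> and then decreases,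
    with \<open>h a = h (a + 1)\<close>; it plays the role of a tangent line to \<open>ln\<close>.\<close>
  define r where "r = real a / real (a + 1)"
  define h where "h = (\<lambda>x. real x * r ^ x)"
  have r: "0 < r" "r \<le> 1" using a by (auto simp: r_def)
  have up: "h x \<le> h (Suc x)" if "x < a" for x
  proof -
    have "real x \<le> real (Suc x) * r"
      using that by (simp add: r_def field_simps)
    then have "real x * r ^ x \<le> (real (Suc x) * r) * r ^ x"
      using r by (intro mult_right_mono) auto
    then show ?thesis by (simp add: h_def mult_ac)
  qed
  have down: "h (Suc x) \<le> h x" if "a \<le> x" for x
  proof -
    have "real (Suc x) * r \<le> real x"
      using that by (simp add: r_def field_simps)
    then have "(real (Suc x) * r) * r ^ x \<le> real x * r ^ x"
      using r by (intro mult_right_mono) auto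
    then show ?thesis by (simp add: h_def mult_ac)
  qed
  have mono: "h x \<le> h y" if "x \<le> y" "y \<le> a" for x y
    using that by (induction y rule: dec_induct) (auto intro: order_trans[OF _ up])
  have anti: "h x \<le> h a" if "a \<le> x" for x
    using that by (induction x rule: dec_induct) (auto intro: order_trans[OF down])
  have h0: "0 \<le> h x" for x using r by (simp add: h_def)
  have peak: "h x \<le> h a" for x
    using mono[of x a] anti[of x] by linarith
  define M where "M = card A * a + k"
  have cA: "card A = Suc (card A - 1)"
    using A by (metis card_gt_0_iff Suc_diff_1 empty_iff)
  \<comment> \<open>Since \<open>r\<close> is at most 1, replacing the sum by its upper bound
    \<open>M\<close> only lowers the power of \<open>r\<close>; the power with the sum as exponent
    then splits among the factors.\<close>
  have "real (prod w A) * r ^ M \<le> real (prod w A) * r ^ sum w A"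
    using sum r by (intro mult_left_mono power_decreasing of_nat_0_le_iff) (auto simp: M_def)
  also have "\<dots> = (\<Prod>x\<in>A. h (w x))"
    by (simp add: h_def prod.distrib power_sum)
  also have "\<dots> = h (w e) * (\<Prod>x\<in>A-{e}. h (w x))"
    using A by (rule prod.remove)
  also have "\<dots> \<le> h b * (\<Prod>x\<in>A-{e}. h a)"
    using mono e h0 peak by (intro mult_mono prod_mono prod_nonneg) auto
  also have "\<dots> = h b * h a ^ (card A - 1)"
    using A by simp
  also have "\<dots> = real b * real a ^ (card A - 1) * r ^ (b + a * (card A - 1))"
    by (simp add: h_def power_mult_distrib power_add power_mult)
  finally have 1: "real (prod w A) * r ^ M \<le>
    real b * real a ^ (card A - 1) * r ^ (b + a * (card A - 1))" .
  \<comment> \<open>The first summand is the exponent of \<open>r\<close> on the right of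
    \<open>1\<close>; cancelling it leaves only the surplus.\<close>
  have M: "M = (b + a * (card A - 1)) + (k + (a - b))"
    unfolding M_def by (subst cA) (use e in \<open>simp add: algebra_simps\<close>)
  have "real (prod w A) * r ^ (k + (a - b)) \<le> real b * real a ^ (card A - 1)"
    using 1 r unfolding M power_add[of r "b + a * (card A - 1)"]
    by (simp add: mult.assoc[symmetric] mult.commute[of _ "r ^ (b + a * (card A - 1))"])
  then have "real (prod w A) * real a ^ (k + (a - b)) \<le>
    real b * real a ^ (card A - 1) * real (a + 1) ^ (k + (a - b))"
    unfolding r_def power_divide by (simp add: field_simps)
  then have "real (prod w A * a ^ (k + (a - b))) \<le>
    real (b * a ^ (card A - 1) * (a + 1) ^ (k + (a - b)))"
    by simp
  then show ?thesis unfolding of_nat_le_iff .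
qed

text \<open>If all factors exceeded \<open>a\<close>, the sum would be at least
  \<open>card A * (a + 1)\<close>, too large as \<open>k < card A\<close>. So some factor is at most
  \<open>a\<close>, and \<open>prod_le_balanced\<close> applies with \<open>b = a\<close>.\<close>

lemma prod_le_of_sum_le:
  fixes w :: "'a \<Rightarrow> nat"
  assumes A: "finite A" and a: "a > 0" and k: "k < card A"
    and sum: "sum w A \<le> card A * a + k"
  shows "prod w A \<le> a ^ (card A - k) * (a + 1) ^ k"
proof -
  have "\<exists>e\<in>A. w e \<le> a"
  proof (rule ccontr)
    assume "\<not> ?thesis"
    then have "(\<Sum>e\<in>A. a + 1) \<le> sum w A" by (intro sum_mono) (auto simp: not_le Suc_le_eq)
    then show False using sum k by simp
  qed
  then obtain e where e: "e \<in> A" "w e \<le> a" by blast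
  have "prod w A * a ^ k \<le> a * a ^ (card A - 1) * (a + 1) ^ k"
    using prod_le_balanced[where w = w and a = a and b = a and k = k, OF A e order_refl a sum] by simp
  also have "a * a ^ (card A - 1) = a ^ (card A - k) * a ^ k"
    using k by (simp flip: power_Suc power_add)
  finally have "prod w A * a ^ k \<le> (a ^ (card A - k) * (a + 1) ^ k) * a ^ k"
    by (simp only: mult_ac)
  then show ?thesis using a by simp
qed

section \<open>Averaging over the 5-sets\<close>

lemma card_nsets_superset:
  assumes "finite V" "e \<subseteq> V" "card e \<le> s"
  shows "card {X \<in> nsets V s. e \<subseteq> X} = (card V - card e) choose (s - card e)"
proof -
  have fe: "finite e" using assms finite_subset by blast
  have "bij_betw (\<lambda>X. X - e) {X \<in> nsets V s. e \<subseteq> X} (nsets (V - e) (s - card e))"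
    using assms fe
    by (intro bij_betw_byWitness[where f' = "\<lambda>Y. Y \<union> e"])
       (auto simp: nsets_def card_Diff_subset card_Un_disjoint Int_Diff 
          intro!: card_Un_disjoint[THEN trans])
  then show ?thesis
    using assms fe by (simp add: bij_betw_same_card card_Diff_subset)
qed

text \<open>Double counting: each \<open>k\<close>-set is counted once for every
  \<open>s\<close>-set that contains it.\<close>

lemma sum_nsets_nsets:
  fixes w :: "'a set \<Rightarrow> nat"
  assumes V: "finite V" and k: "k \<le> s"
  shows "(\<Sum>X\<in>nsets V s. \<Sum>e\<in>nsets X k. w e) = ((card V - k) choose (s - k)) * (\<Sum>e\<in>nsets V k. w e)"
proof -
  have "(\<Sum>X\<in>nsets V s. \<Sum>e\<in>nsets X k. w e) = (\<Sum>X\<in>nsets V s. \<Sum>e\<in>{e \<in> nsets V k. e \<subseteq> X}. w e)"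
    by (intro sum.cong) (auto simp: nsets_def)
  also have "\<dots> = (\<Sum>e\<in>nsets V k. \<Sum>X\<in>{X \<in> nsets V s. e \<subseteq> X}. w e)"
    using V by (intro sum.swap_restrict finite_imp_finite_nsets)
  also have "\<dots> = (\<Sum>e\<in>nsets V k. ((card V - k) choose (s - k)) * w e)"
    using card_nsets_superset[OF V] k by (intro sum.cong) (auto simp: nsets_def)
  finally show ?thesis by (simp add: sum_distrib_left)
qed

lemma sq_graph_sum_le:
  assumes w: "sq_graph V 5 (10 * a + 4) w" and V: "finite V" "card V \<ge> 5"
  shows "(\<Sum>e\<in>nsets V 2. w e) \<le> (card V choose 2) * a + 2 * (card V choose 2) div 5"
proof -
  define c N where "c = (card V - 2) choose 3" and "N = card V choose 2"
  have c: "c > 0" using V by (simp add: c_def)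
  have "c * (\<Sum>e\<in>nsets V 2. w e) = (\<Sum>X\<in>nsets V 5. \<Sum>e\<in>nsets X 2. w e)"
    using sum_nsets_nsets[OF V(1), of 2 5 w] by (simp add: c_def)
  also have "\<dots> \<le> (\<Sum>X\<in>nsets V 5. 10 * a + 4)"
    using w by (intro sum_mono) (auto simp: sq_graph_def)
  also have "\<dots> = (card V choose 5) * (10 * a + 4)" by simp
  \<comment> \<open>The factor 5 exposes \<open>5 choose 2 = 10\<close>, because
    \<open>5 * (10 * a + 4) = 10 * (5 * a + 2)\<close>. Then \<open>choose_mult\<close> trades the
    number of 5-sets for \<open>N * c\<close>, and \<open>c\<close> cancels without
    division.\<close>
  finally have "5 * (c * (\<Sum>e\<in>nsets V 2. w e)) \<le> 5 * ((card V choose 5) * (10 * a + 4))"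
    by (rule mult_le_mono2)
  also have "\<dots> = ((card V choose 5) * 10) * (5 * a + 2)" by (simp add: algebra_simps)
  also have "(card V choose 5) * 10 = N * c"
    using choose_mult[of 2 5 "card V"] V by (simp add: c_def N_def choose_two[of 5])
  finally have "c * (5 * (\<Sum>e\<in>nsets V 2. w e)) \<le> c * (N * (5 * a + 2))"
    by (simp only: mult_ac)
  then have "5 * (\<Sum>e\<in>nsets V 2. w e) \<le> N * (5 * a + 2)" using c by (simp only: mult_le_cancel1)
  also have "\<dots> = 5 * (N * a) + 2 * N" by (simp add: algebra_simps)
  finally show ?thesis unfolding N_def by linarith
qed

lemma edge_product_le:
  assumes w: "sq_graph V 5 (10 * a + 4) w" and V: "finite V" "card V \<ge> 5"
    and N: "N = card V choose 2" and a: "a > 0"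
  shows "edge_product V w \<le> a ^ (N - 2 * N div 5) * (a + 1) ^ (2 * N div 5)"
proof -
  have "N > 0" using V by (simp add: N)
  then have "2 * N div 5 < N" by linarith
  then show ?thesis
    using prod_le_of_sum_le[of "nsets V 2" a "2 * N div 5" w] sq_graph_sum_le[OF w V] V(1) a
    by (simp add: edge_product_def finite_imp_finite_nsets N)
qed

section \<open>Multigraphs with two homogeneous parts\<close>

lemma nsets_2_Un_eq:
  assumes "A \<inter> B = {}"
  shows "nsets (A \<union> B) 2 = nsets A 2 \<union> nsets B 2 \<union> (\<lambda>(x, y). {x, y}) ` (A \<times> B)"
  unfolding nsets_disjoint_2[OF assms] by auto

text \<open>The edges inside \<open>A\<close>, those inside \<open>B\<close> and the crossing ones
  partition the edge set. The sum serves to check the 5-set condition, the product to evaluate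
  \<open>edge_product\<close>.\<close>

lemma
  fixes w :: "'a set \<Rightarrow> nat"
  assumes fin: "finite A" "finite B" and disj: "A \<inter> B = {}"
    and A: "\<And>e. e \<in> nsets A 2 \<Longrightarrow> w e = p"
    and B: "\<And>e. e \<in> nsets B 2 \<Longrightarrow> w e = q"
    and AB: "\<And>x y. x \<in> A \<Longrightarrow> y \<in> B \<Longrightarrow> w {x, y} = r"
  shows sum_nsets_2_Un: "(\<Sum>e\<in>nsets (A \<union> B) 2. w e) =
      (card A choose 2) * p + (card B choose 2) * q + card A * card B * r"
    and prod_nsets_2_Un: "(\<Prod>e\<in>nsets (A \<union> B) 2. w e) =
      p ^ (card A choose 2) * q ^ (card B choose 2) * r ^ (card A * card B)"
proof -
  let ?g = "\<lambda>(x, y). {x, y}"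
  have inj: "inj_on ?g (A \<times> B)"
    using disj by (auto simp: inj_on_def doubleton_eq_iff)
  have d1: "nsets A 2 \<inter> nsets B 2 = {}"
  proof (rule ccontr)
    assume "nsets A 2 \<inter> nsets B 2 \<noteq> {}"
    then obtain e where "e \<subseteq> A \<inter> B" "card e = 2" by (auto simp: nsets_def)
    then show False using disj by simp
  qed
  have d2: "(nsets A 2 \<union> nsets B 2) \<inter> ?g ` (A \<times> B) = {}"
    using disj by (auto simp: nsets_def)
  note d = d1 d2
  have f: "finite (nsets A 2)" "finite (nsets B 2)" "finite (?g ` (A \<times> B))"
    using fin by (auto simp: finite_imp_finite_nsets)
  have c: "(w \<circ> ?g) z = r" if "z \<in> A \<times> B" for z using that AB by auto
  have s: "sum w (?g ` (A \<times> B)) = card A * card B * r"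
    using sum.cong[OF refl c, of "A \<times> B"]
    by (simp add: sum.reindex[OF inj] card_cartesian_product)
  have p: "prod w (?g ` (A \<times> B)) = r ^ (card A * card B)"
    using prod.cong[OF refl c, of "A \<times> B"]
    by (simp add: prod.reindex[OF inj] card_cartesian_product)
  show "(\<Sum>e\<in>nsets (A \<union> B) 2. w e) =
      (card A choose 2) * p + (card B choose 2) * q + card A * card B * r"
    unfolding nsets_2_Un_eq[OF disj]
    using f d s A B by (simp add: sum.union_disjoint)
  show "(\<Prod>e\<in>nsets (A \<union> B) 2. w e) =
      p ^ (card A choose 2) * q ^ (card B choose 2) * r ^ (card A * card B)"
    unfolding nsets_2_Un_eq[OF disj]
    using f d p A B by (simp add: prod.union_disjoint)
qed

text \<open>One construction for two uses: \<open>a - 2\<close>, \<open>a\<close>,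
  \<open>a + 1\<close> gives the Turan-type graphs, and \<open>a + 1\<close>, \<open>a + 1\<close>,
  \<open>a\<close> the two heavy triangles on six vertices. The restriction supplies the
  extensionality that \<open>multigraphs\<close> demands.\<close>

definition bipart_graph :: "'a set \<Rightarrow> 'a set \<Rightarrow> nat \<Rightarrow> nat \<Rightarrow> nat \<Rightarrow> 'a set \<Rightarrow> nat" where
  "bipart_graph A B p q r =
     restrict (\<lambda>e. if e \<subseteq> A then p else if e \<subseteq> B then q else r) (nsets (A \<union> B) 2)"

lemma bipart_graph:
  assumes "A \<inter> B = {}"
  shows "bipart_graph A B p q r \<in> multigraphs (A \<union> B)"
    and "e \<in> nsets A 2 \<Longrightarrow> bipart_graph A B p q r e = p"
    and "e \<in> nsets B 2 \<Longrightarrow> bipart_graph A B p q r e = q"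
    and "x \<in> A \<Longrightarrow> y \<in> B \<Longrightarrow> bipart_graph A B p q r {x, y} = r"
    and "e \<in> nsets (A \<union> B) 2 \<Longrightarrow> \<not> e \<subseteq> A \<Longrightarrow> \<not> e \<subseteq> B \<Longrightarrow> bipart_graph A B p q r e = r"
  using assms by (auto simp: bipart_graph_def multigraphs_def nsets_2_eq)

text \<open>The weight of an \<open>s\<close>-set depends only on how many of its vertices lie in
  each part, so the condition reduces to a check over pairs \<open>i\<close>,
  \<open>j\<close>.\<close>

lemma sq_graph_bipartition:
  assumes fin: "finite A" "finite B" and disj: "A \<inter> B = {}"
    and w: "w \<in> multigraphs (A \<union> B)"
    and A: "\<And>e. e \<in> nsets A 2 \<Longrightarrow> w e = p"
    and B: "\<And>e. e \<in> nsets B 2 \<Longrightarrow> w e = q"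
    and AB: "\<And>x y. x \<in> A \<Longrightarrow> y \<in> B \<Longrightarrow> w {x, y} = r"
    and le: "\<And>i j. i \<le> card A \<Longrightarrow> j \<le> card B \<Longrightarrow> i + j = s \<Longrightarrow>
      (i choose 2) * p + (j choose 2) * q + i * j * r \<le> m"
  shows "sq_graph (A \<union> B) s m w"
  unfolding sq_graph_def
proof (intro conjI ballI w)
  fix X assume X: "X \<in> nsets (A \<union> B) s"
  let ?A = "A \<inter> X" and ?B = "B \<inter> X"
  have X_eq: "X = ?A \<union> ?B" using X by (auto simp: nsets_def)
  have "sum w (nsets (?A \<union> ?B) 2) =
      (card ?A choose 2) * p + (card ?B choose 2) * q + card ?A * card ?B * r"
    using fin disj by (intro sum_nsets_2_Un) (auto intro: A B AB simp: nsets_def)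
  also have "\<dots> \<le> m"
  proof (rule le)
    show "card ?A \<le> card A" "card ?B \<le> card B" using fin by (auto intro: card_mono)
    have "card ?A + card ?B = card X"
      using fin disj by (subst X_eq, subst card_Un_disjoint) auto
    then show "card ?A + card ?B = s" using X by (simp add: nsets_def)
  qed
  finally show "sum w (nsets X 2) \<le> m" using X_eq by simp
qed

section \<open>Turan-type graphs with two parts\<close>

text \<open>The edge product of a graph in \<open>turan_graphs 2 2 a n\<close> whose part
  \<open>V_0\<close> has \<open>k\<close> vertices.\<close>

definition turan_weight :: "nat \<Rightarrow> nat \<Rightarrow> nat \<Rightarrow> nat" where
  "turan_weight a n k = (a - 2) ^ (k choose 2) * a ^ ((n - k) choose 2) * (a + 1) ^ (k * (n - k))"

lemma turan_graphs_2_iff: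
  "w \<in> turan_graphs 2 d a n \<longleftrightarrow> w \<in> multigraphs {1..n} \<and>
     (\<exists>A B. A \<inter> B = {} \<and> A \<union> B = {1..n} \<and> (\<forall>e\<in>nsets A 2. w e = a - d) \<and>
        (\<forall>e\<in>nsets B 2. w e = a) \<and>
        (\<forall>e\<in>nsets {1..n} 2. \<not> e \<subseteq> A \<and> \<not> e \<subseteq> B \<longrightarrow> w e = a + 1))"
  (is "_ \<longleftrightarrow> _ \<and> ?R")
proof -
  have sets: "{..<2} = {0, 1::nat}" "{1..<2} = {1::nat}" and all: "(\<forall>i<2. P i) \<longleftrightarrow> P 0 \<and> P 1" for P :: "nat \<Rightarrow> bool"
    by (auto simp: less_2_cases_iff)
  have "(\<exists>U :: nat \<Rightarrow> nat set.
          disjoint_family_on U {..<2} \<and> (\<Union>i<2. U i) = {1..n} \<and>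
          (\<forall>e\<in>nsets (U 0) 2. w e = a - d) \<and>
          (\<forall>i\<in>{1..<2}. \<forall>e\<in>nsets (U i) 2. w e = a) \<and>
          (\<forall>e\<in>nsets {1..n} 2. (\<forall>i<2. \<not> e \<subseteq> U i) \<longrightarrow> w e = a + 1)) \<longleftrightarrow> ?R" (is "?L \<longleftrightarrow> ?R")
  proof
    assume ?L
    then obtain U :: "nat \<Rightarrow> nat set" where
      "disjoint_family_on U {..<2} \<and> (\<Union>i<2. U i) = {1..n} \<and>
          (\<forall>e\<in>nsets (U 0) 2. w e = a - d) \<and>
          (\<forall>i\<in>{1..<2}. \<forall>e\<in>nsets (U i) 2. w e = a) \<and>
          (\<forall>e\<in>nsets {1..n} 2. (\<forall>i<2. \<not> e \<subseteq> U i) \<longrightarrow> w e = a + 1)" ..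
    then show ?R
      unfolding sets all
      by - (rule exI[of _ "U 0"], rule exI[of _ "U 1"], auto simp: disjoint_family_on_def)
  next
    assume ?R
    then obtain A B where "A \<inter> B = {} \<and> A \<union> B = {1..n} \<and> (\<forall>e\<in>nsets A 2. w e = a - d) \<and>
        (\<forall>e\<in>nsets B 2. w e = a) \<and>
        (\<forall>e\<in>nsets {1..n} 2. \<not> e \<subseteq> A \<and> \<not> e \<subseteq> B \<longrightarrow> w e = a + 1)" by blast
    then show ?L
      unfolding sets all
      by (intro exI[of _ "\<lambda>i. if i = 0 then A else B"]) (auto simp: disjoint_family_on_def)
  qed
  then show ?thesis by (simp add: turan_graphs_def)
qed

lemma turan_graphsE:
  assumes "w \<in> turan_graphs 2 d a n"
  obtains A B where "w \<in> multigraphs (A \<union> B)" "A \<inter> B = {}" "A \<union> B = {1..n}" "finite A" "finite B"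
    "\<And>e. e \<in> nsets A 2 \<Longrightarrow> w e = a - d" "\<And>e. e \<in> nsets B 2 \<Longrightarrow> w e = a"
    "\<And>x y. x \<in> A \<Longrightarrow> y \<in> B \<Longrightarrow> w {x, y} = a + 1"
proof -
  from assms have "w \<in> multigraphs {1..n}" and
    "\<exists>A B. A \<inter> B = {} \<and> A \<union> B = {1..n} \<and> (\<forall>e\<in>nsets A 2. w e = a - d) \<and>
        (\<forall>e\<in>nsets B 2. w e = a) \<and>
        (\<forall>e\<in>nsets {1..n} 2. \<not> e \<subseteq> A \<and> \<not> e \<subseteq> B \<longrightarrow> w e = a + 1)"
    unfolding turan_graphs_2_iff by - (erule conjunct1, erule conjunct2)
  then obtain A B where AB: "w \<in> multigraphs {1..n}" "A \<inter> B = {}" "A \<union> B = {1..n}"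
      "\<forall>e\<in>nsets A 2. w e = a - d" "\<forall>e\<in>nsets B 2. w e = a"
    and X: "\<forall>e\<in>nsets {1..n} 2. \<not> e \<subseteq> A \<and> \<not> e \<subseteq> B \<longrightarrow> w e = a + 1"
    by (elim exE conjE)
  have cross: "w {x, y} = a + 1" if "x \<in> A" "y \<in> B" for x y
  proof (rule X[rule_format])
    show "{x, y} \<in> nsets {1..n} 2" using that AB(2) unfolding AB(3)[symmetric] by auto
    show "\<not> {x, y} \<subseteq> A \<and> \<not> {x, y} \<subseteq> B" using that AB(2) by blast
  qed
  show thesis
  proof (rule that[OF _ AB(2,3) _ _ _ _ cross])
    show "finite A" "finite B"
      using finite_atLeastAtMost[of 1 n] unfolding AB(3)[symmetric] by simp_all
    show "w \<in> multigraphs (A \<union> B)" using AB(1,3) by simp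
  qed (use AB(4,5) in blast)+
qed

text \<open>The product depends only on the size of \<open>V_0\<close>, and every size from 0 to
  \<open>n\<close> occurs since parts may be empty. So the maximum over graphs becomes one over
  \<open>n + 1\<close> explicit numbers.\<close>

lemma turan_graphs_image:
  "edge_product {1..n} ` turan_graphs 2 2 a n = turan_weight a n ` {..n}"
proof (intro equalityI subsetI)
  fix P assume "P \<in> edge_product {1..n} ` turan_graphs 2 2 a n"
  then obtain w where w: "w \<in> turan_graphs 2 2 a n" and P: "P = edge_product {1..n} w" by blast
  from w show "P \<in> turan_weight a n ` {..n}"
  proof (cases rule: turan_graphsE)
    case (1 A B)
    have "card A + card B = n" using 1 card_Un_disjoint[of A B] by simp
    then have "card A \<le> n" "card B = n - card A" by auto
    then show ?thesis
      using prod_nsets_2_Un[of A B w "a - 2" a "a + 1"] 1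
      by (auto simp: P edge_product_def turan_weight_def image_iff)
  qed
next
  fix P assume "P \<in> turan_weight a n ` {..n}"
  then obtain k where k: "k \<le> n" "P = turan_weight a n k" by auto
  define A B where "A = {1..k}" and "B = {k + 1..n}"
  have AB: "A \<inter> B = {}" "A \<union> B = {1..n}" "finite A" "finite B" "card A = k" "card B = n - k"
    using k by (auto simp: A_def B_def)
  let ?w = "bipart_graph A B (a - 2) a (a + 1)"
  note w = bipart_graph[where p = "a - 2" and q = a and r = "a + 1", OF AB(1)]
  have "?w \<in> turan_graphs 2 2 a n"
    unfolding turan_graphs_2_iff using w AB by (metis (no_types, lifting))
  moreover have "edge_product {1..n} ?w = P"
    using prod_nsets_2_Un[where w = ?w, OF AB(3,4,1) w(2,3,4)] AB k by (simp add: edge_product_def turan_weight_def)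
  ultimately show "P \<in> edge_product {1..n} ` turan_graphs 2 2 a n" by blast
qed

lemma turan_Pi_eq: "turan_Pi 2 2 a n = Max (turan_weight a n ` {..n})"
  unfolding turan_Pi_def turan_graphs_image ..

text \<open>A 5-set with \<open>i\<close> vertices in \<open>V_0\<close> has weight
  \<open>10 * a\<close> plus \<open>2 * i * (3 - i)\<close>, read over the integers. This excess is
  0, 4, 4, 0, -8, -20 for \<open>i\<close> from 0 to 5.\<close>

lemma turan_graphs_subset_nsq_graphs:
  assumes "a \<ge> 2"
  shows "turan_graphs 2 2 a n \<subseteq> nsq_graphs n 5 (10 * a + 4)"
proof
  fix w assume "w \<in> turan_graphs 2 2 a n"
  then show "w \<in> nsq_graphs n 5 (10 * a + 4)"
  proof (cases rule: turan_graphsE)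
    case (1 A B)
    obtain b where b: "a = b + 2" using assms by (metis add.commute le_Suc_ex)
    have "sq_graph (A \<union> B) 5 (10 * a + 4) w"
    proof (rule sq_graph_bipartition[OF 1(4,5,2,1,6-8)])
      fix i j :: nat assume ij: "i + j = 5"
      then have "j = 5 - i" "i = 0 \<or> i = 1 \<or> i = 2 \<or> i = 3 \<or> i = 4 \<or> i = 5" by linarith+
      then show "(i choose 2) * (a - 2) + (j choose 2) * a + i * j * (a + 1) \<le> 10 * a + 4"
        by (auto simp: choose_two b)
    qed
    then show ?thesis using 1 by (simp add: nsq_graphs_def)
  qed
qed

section \<open>Existence of the maximum and general bounds\<close>

context
  fixes n a :: nat
  assumes n: "n \<ge> 5" and a: "a > 0"
begin

text \<open>The general upper bound already confines the products to an initial segment, so single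
  multiplicities need not be bounded.\<close>

lemma finite_products: "finite (edge_product {1..n} ` nsq_graphs n 5 (10 * a + 4))"
proof (rule finite_subset)
  define N where "N = n choose 2"
  show "edge_product {1..n} ` nsq_graphs n 5 (10 * a + 4) \<subseteq> {..a ^ (N - 2 * N div 5) * (a + 1) ^ (2 * N div 5)}"
    using edge_product_le[of "{1..n}" a _ N] n a by (auto simp: nsq_graphs_def N_def)
qed auto

lemma edge_product_le_ex_Pi:
  "w \<in> nsq_graphs n 5 (10 * a + 4) \<Longrightarrow> edge_product {1..n} w \<le> ex_Pi n 5 (10 * a + 4)"
  unfolding ex_Pi_def using finite_products by (intro Max_ge) auto

lemma ex_Pi_attained:
  obtains w where "w \<in> nsq_graphs n 5 (10 * a + 4)" "ex_Pi n 5 (10 * a + 4) = edge_product {1..n} w"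
proof -
  \<comment> \<open>The zero multigraph only witnesses that the set of products is nonempty, so that
    \<open>Max_in\<close> applies.\<close>
  define w where "w = restrict (\<lambda>_. 0::nat) (nsets {1..n} 2)"
  have "sum w (nsets X 2) = 0" if "X \<in> nsets {1..n} 5" for X
    using nsets_mono[of X "{1..n}" 2] that by (intro sum.neutral) (auto simp: w_def nsets_def)
  then have "w \<in> nsq_graphs n 5 (10 * a + 4)"
    by (auto simp: nsq_graphs_def sq_graph_def multigraphs_def w_def)
  then have "ex_Pi n 5 (10 * a + 4) \<in> edge_product {1..n} ` nsq_graphs n 5 (10 * a + 4)"
    unfolding ex_Pi_def by (intro Max_in finite_products) auto
  then show thesis using that by blast
qed

lemma ex_Pi_le:
  assumes "N = n choose 2"
  shows "ex_Pi n 5 (10 * a + 4) \<le> a ^ (N - 2 * N div 5) * (a + 1) ^ (2 * N div 5)"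
proof (rule ex_Pi_attained)
  fix w assume "w \<in> nsq_graphs n 5 (10 * a + 4)" "ex_Pi n 5 (10 * a + 4) = edge_product {1..n} w"
  then show ?thesis
    using edge_product_le[of "{1..n}" a w N] n a assms by (auto simp: nsq_graphs_def)
qed

lemma turan_Pi_le_ex_Pi: 
  assumes "a \<ge> 2"
  shows "turan_Pi 2 2 a n \<le> ex_Pi n 5 (10 * a + 4)"
proof -
  have "turan_weight a n ` {..n} \<noteq> {}" by simp
  then have "turan_graphs 2 2 a n \<noteq> {}" using turan_graphs_image[of n a] by auto
  then show ?thesis
    unfolding turan_Pi_def ex_Pi_def
    using finite_products turan_graphs_subset_nsq_graphs[OF assms, of n] by (intro Max_mono) auto
qed

end

section \<open>Limit of the ratio\<close>

lemma turan_weight_le_turan_Pi: "k \<le> n \<Longrightarrow> turan_weight a n k \<le> turan_Pi 2 2 a n"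
  unfolding turan_Pi_eq by (intro Max_ge) auto

lemma ratio_tendsto_1:
  assumes n: "n \<ge> 5"
  shows "(\<lambda>a. real (ex_Pi n 5 (10 * a + 4)) / real (turan_Pi 2 2 a n)) \<longlonglongrightarrow> 1"
proof (rule tendsto_sandwich)
  define N k where "N = n choose 2" and "k = 2 * N div 5"
  have kN: "k \<le> N" by (simp add: k_def)
  \<comment> \<open>An empty \<open>V_0\<close> makes all multiplicities equal to
    \<open>a\<close>.\<close>
  have T: "a ^ N \<le> turan_Pi 2 2 a n" for a
    using turan_weight_le_turan_Pi[of 0 n a] by (simp add: turan_weight_def N_def choose_two[of 0])
  show "\<forall>\<^sub>F a in sequentially. 1 \<le> real (ex_Pi n 5 (10 * a + 4)) / real (turan_Pi 2 2 a n)"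
    using eventually_ge_at_top[of 2]
  proof eventually_elim
    case (elim a)
    \<comment> \<open>The denominator must be positive here, since division by 0 would give the
      value 0.\<close>
    have "0 < a ^ N" using elim by simp
    then have "0 < turan_Pi 2 2 a n" using T[of a] by linarith
    then show ?case using turan_Pi_le_ex_Pi[of n a] n elim by simp
  qed
  show "\<forall>\<^sub>F a in sequentially. real (ex_Pi n 5 (10 * a + 4)) / real (turan_Pi 2 2 a n) \<le> (1 + inverse (real a)) ^ k"
    using eventually_ge_at_top[of 1]
  proof eventually_elim
    case (elim a)
    have "real (ex_Pi n 5 (10 * a + 4)) / real (turan_Pi 2 2 a n) \<le> real (a ^ (N - k) * (a + 1) ^ k) / real (a ^ N)"
      using elim ex_Pi_le[of n a N] n T[of a] unfolding N_def[symmetric] k_def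
      by (intro frac_le) (auto simp del: of_nat_power of_nat_mult simp: of_nat_le_iff)
    also have "\<dots> = real (a + 1) ^ k / real a ^ k"
    proof -
      have "real (a ^ N) = real a ^ (N - k) * real a ^ k" using kN by (simp flip: power_add)
      then show ?thesis using elim by simp
    qed
    also have "\<dots> = (1 + inverse (real a)) ^ k"
      using elim by (simp add: field_simps flip: power_divide)
    finally show ?case .
  qed
  have "(\<lambda>a. (1 + inverse (real a)) ^ k) \<longlonglongrightarrow> (1 + 0) ^ k"
    by (intro tendsto_intros lim_inverse_n)
  then show "(\<lambda>a. (1 + inverse (real a)) ^ k) \<longlonglongrightarrow> 1" by simp
qed simp

section \<open>Seven vertices\<close>

text \<open>The handshake identity: every edge is met once in each order. It turns sums over 2-sets
  into sums over a symmetric matrix, where deleting vertices means deleting rows and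
  columns.\<close>

lemma sum_sum_eq_sum_nsets_2:
  fixes f :: "'a set \<Rightarrow> int"
  assumes "finite X"
  shows "(\<Sum>u\<in>X. \<Sum>v\<in>X. if u = v then 0 else f {u, v}) = 2 * (\<Sum>e\<in>nsets X 2. f e)"
  using assms
proof (induction X rule: finite_induct)
  case empty
  then show ?case by (simp add: nsets_empty_iff)
next
  case (insert x X)
  let ?g = "\<lambda>u v. if u = v then 0 else f {u, v}"
  have "nsets (insert x X) 2 = nsets X 2 \<union> (\<lambda>y. {x, y}) ` X"
    using insert.hyps by (fastforce simp: nsets_2_eq)
  moreover have "nsets X 2 \<inter> (\<lambda>y. {x, y}) ` X = {}"
    using insert.hyps by (auto simp: nsets_2_eq doubleton_eq_iff)
  moreover have "inj_on (\<lambda>y. {x, y}) X" by (auto simp: inj_on_def doubleton_eq_iff)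
  ultimately have "(\<Sum>e\<in>nsets (insert x X) 2. f e) = (\<Sum>e\<in>nsets X 2. f e) + (\<Sum>y\<in>X. f {x, y})"
    using insert.hyps by (simp add: sum.union_disjoint finite_imp_finite_nsets sum.reindex)
  moreover have "(\<Sum>y\<in>X. f {x, y}) = (\<Sum>y\<in>X. ?g x y)" "(\<Sum>y\<in>X. f {x, y}) = (\<Sum>y\<in>X. ?g y x)"
    using insert.hyps by (auto intro!: sum.cong simp: insert_commute)
  ultimately show ?case using insert by (simp add: sum.distrib)
qed

text \<open>For the weighted degrees \<open>D\<close>, the condition on the 5-set \<open>V - {u, v}\<close> says
  \<open>D u + D v \<ge> 4 + f {u, v}\<close>. Hence all degrees are at least 2,
  and since they sum to 16, at least five vertices have degree exactly 2; the pairs among these have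
  weight at most 0, so the edge joining the other two must have weight at most \<open>- 2\<close>.\<close>

lemma seven_vertices_light_edge:
  fixes f :: "'a set \<Rightarrow> int"
  assumes V: "card V = 7"
    and le: "\<And>X. X \<in> nsets V 5 \<Longrightarrow> (\<Sum>e\<in>nsets X 2. f e) \<le> 4"
    and total: "(\<Sum>e\<in>nsets V 2. f e) = 8"
  obtains e where "e \<in> nsets V 2" "f e \<le> -2"
proof -
  have fin: "finite V" using V by (simp add: card_ge_0_finite)
  define g where "g = (\<lambda>u v. if u = v then 0 else f {u, v})"
  have sym: "g u v = g v u" for u v by (simp add: g_def insert_commute)
  have g0: "g u u = 0" for u by (simp add: g_def)
  define D where "D = (\<lambda>u. \<Sum>v\<in>V. g u v)"
  define S where "S = (\<lambda>X. \<Sum>u\<in>X. \<Sum>v\<in>X. g u v)"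
  have S_eq: "S X = 2 * (\<Sum>e\<in>nsets X 2. f e)" if "X \<subseteq> V" for X
    unfolding S_def g_def using that fin by (intro sum_sum_eq_sum_nsets_2) (rule finite_subset)
  have SV: "(\<Sum>u\<in>V. D u) = 16" using S_eq[of V] total by (simp add: S_def D_def)
  have col: "(\<Sum>x\<in>V. g x u) = D u" for u
    unfolding D_def using sym by (intro sum.cong refl)
  \<comment> \<open>Deleting the rows and columns of \<open>u\<close> and \<open>v\<close> from the
    matrix \<open>g\<close> of total 16 subtracts the entries at \<open>(u, v)\<close> and
    \<open>(v, u)\<close> twice each; hence the correction \<open>2 * g u v\<close>.\<close>
  have S_diff: "S (V - {u, v}) = 16 - 2 * D u - 2 * D v + 2 * g u v"
    if uv: "u \<in> V" "v \<in> V" "u \<noteq> v" for u v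
  proof -
    have rem: "sum h (V - {u, v}) = sum h V - h u - h v" for h :: "'a \<Rightarrow> int"
      using uv fin by (simp add: sum_diff)
    have "S (V - {u, v}) = (\<Sum>x\<in>V-{u,v}. D x - g x u - g x v)"
      unfolding S_def D_def rem ..
    also have "\<dots> = 16 - D u - D v - (D u - g u u - g v u) - (D v - g u v - g v v)"
      by (simp only: sum_subtractf rem col SV)
    finally show ?thesis by (simp add: g0 sym[of v u])
  qed
  have pair: "D u + D v \<ge> 4 + g u v" if uv: "u \<in> V" "v \<in> V" "u \<noteq> v" for u v
  proof -
    have "V - {u, v} \<in> nsets V 5" using uv V fin by (simp add: nsets_def card_Diff_subset)
    from le[OF this] S_diff[OF uv] S_eq[of "V - {u, v}"] show ?thesis by auto
  qed
  \<comment> \<open>Adding \<open>pair\<close> over the six other vertices gives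
    \<open>24 + D u\<close> on the left and \<open>6 * D u + (16 - D u)\<close> on the
    right.\<close>
  have D2: "D u \<ge> 2" if u: "u \<in> V" for u
  proof -
    have c: "card (V - {u}) = 6" using u V fin by simp
    have "(\<Sum>v\<in>V-{u}. 4 + g u v) \<le> (\<Sum>v\<in>V-{u}. D u + D v)"
      using pair u by (intro sum_mono) auto
    also have "\<dots> = 6 * D u + (16 - D u)"
      using u fin c SV by (simp add: sum.distrib sum_diff1)
    also have "(\<Sum>v\<in>V-{u}. 4 + g u v) = 24 + D u"
      using u fin c by (simp add: sum.distrib sum_diff1 g0 D_def)
    finally show ?thesis by linarith
  qed
  define T where "T = {u \<in> V. D u \<noteq> 2}"
  have TV: "T \<subseteq> V" by (auto simp: T_def)
  \<comment> \<open>The excess of the degrees over 2 is \<open>16 - 7 * 2 = 2\<close> in total, and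
    each vertex of \<open>T\<close> uses at least 1 of it.\<close>
  have "int (card T) = (\<Sum>u\<in>T. 1)" by simp
  also have "\<dots> \<le> (\<Sum>u\<in>T. D u - 2)"
    using D2 by (intro sum_mono) (force simp: T_def)
  also have "\<dots> \<le> (\<Sum>u\<in>V. D u - 2)"
    using D2 fin TV by (intro sum_mono2) auto
  also have "\<dots> = 2" using SV V by (simp add: sum_subtractf)
  finally have "card T \<le> 2" by simp
  \<comment> \<open>\<open>T\<close> may have fewer than two elements, so it is padded to a pair;
    every vertex outside the pair still has degree 2.\<close>
  with TV fin V obtain P where P: "T \<subseteq> P" "P \<subseteq> V" "card P = 2"
    using exists_subset_between[of T 2 V] by auto
  then obtain x y where xy: "P = {x, y}" "x \<noteq> y" by (auto simp: card_2_iff)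
  have xyV: "x \<in> V" "y \<in> V" using P xy by auto
  have D_rest: "D u = 2" if "u \<in> V - {x, y}" for u using that P xy by (auto simp: T_def)
  have "(\<Sum>u\<in>V-{x,y}. D u) = (\<Sum>u\<in>V-{x,y}. 2)" using D_rest by (intro sum.cong) auto
  then have Dxy: "D x + D y = 6"
    using SV V fin xyV xy by (simp add: sum_diff card_Diff_subset)
  have "S (V - {x, y}) \<le> 0"
    unfolding S_def
  proof (intro sum_nonpos)
    fix u v assume uv: "u \<in> V - {x, y}" "v \<in> V - {x, y}"
    show "g u v \<le> 0" using pair[of u v] D_rest[OF uv(1)] D_rest[OF uv(2)] uv g0
      by (cases "u = v") auto
  qed
  then have "g x y \<le> -2" using S_diff[OF xyV xy(2)] Dxy by linarith
  then have "f {x, y} \<le> -2" using xy by (simp add: g_def)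
  moreover have "{x, y} \<in> nsets V 2" using xyV xy by simp
  ultimately show thesis using that by blast
qed


lemma ex_Pi_7_ge:
  assumes a: "a \<ge> 2"
  shows "(a - 2) * (a + 1) ^ 10 * a ^ 10 \<le> ex_Pi 7 5 (10 * a + 4)"
proof -
  have "(a - 2) * (a + 1) ^ 10 * a ^ 10 \<le> turan_Pi 2 2 a 7"
    using turan_weight_le_turan_Pi[of 2 7 a] by (simp add: turan_weight_def choose_two mult_ac)
  also have "\<dots> \<le> ex_Pi 7 5 (10 * a + 4)"
    using a by (intro turan_Pi_le_ex_Pi) auto
  finally show ?thesis .
qed

text \<open>Unfolds numeral exponents and sorts the factors, which decides identities between
  monomials while \<open>a - 2\<close>, \<open>a - 1\<close> and \<open>a + 1\<close> stay
  atoms.\<close>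

lemmas expand_powers = eval_nat_numeral BitM.simps numeral_One power_Suc power_0 mult_1_right mult_1_left mult_ac

lemma ex_Pi_7_less:
  assumes a: "a \<ge> 3"
  shows "ex_Pi 7 5 (10 * a + 4) < (a - 1) * a ^ 11 * (a + 1) ^ 9"
proof (rule ex_Pi_attained[of 7 a])
  fix w assume w: "w \<in> nsq_graphs 7 5 (10 * a + 4)" and P: "ex_Pi 7 5 (10 * a + 4) = edge_product {1..7} w"
  let ?E = "nsets {1..7::nat} 2"
  have sq: "sq_graph {1..7} 5 (10 * a + 4) w" using w by (simp add: nsq_graphs_def)
  have E: "finite ?E" "card ?E = 21" by (simp_all add: finite_imp_finite_nsets choose_two)
  have sum: "sum w ?E \<le> 21 * a + 8" using sq_graph_sum_le[OF sq] by (simp add: choose_two)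
  obtain c where c: "a = c + 2" "c > 0" using a by (intro that[of "a - 2"]) auto
  have "edge_product {1..7} w < (a - 1) * a ^ 11 * (a + 1) ^ 9"
  proof (cases "sum w ?E = 21 * a + 8")
    case True
    \<comment> \<open>Subtracting \<open>a\<close> from each multiplicity turns the bounds
      \<open>10 * a + 4\<close> and \<open>21 * a + 8\<close> into 4 and 8; integers are used since
      excesses may be negative.\<close>
    define f where "f = (\<lambda>e. int (w e) - int a)"
    have f: "sum f (nsets X 2) = int (sum w (nsets X 2)) - int (card X choose 2) * int a" for X
      by (simp add: f_def sum_subtractf)
    obtain e where e: "e \<in> ?E" "f e \<le> -2"
    proof (rule seven_vertices_light_edge[of "{1..7::nat}" f])
      show "sum f (nsets X 2) \<le> 4" if "X \<in> nsets {1..7} 5" for X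
      proof -
        have "sum w (nsets X 2) \<le> 10 * a + 4" using sq that by (simp add: sq_graph_def)
        moreover have "card X = 5" using that by (simp add: nsets_def)
        ultimately show ?thesis unfolding f by (simp add: choose_two del: of_nat_sum)
      qed
      show "sum f ?E = 8" unfolding f using True by (simp add: choose_two del: of_nat_sum)
    qed simp
    have "prod w ?E * a ^ 10 \<le> (a - 2) * a ^ 20 * (a + 1) ^ 10"
      using prod_le_balanced[where A = ?E and e = e and w = w and b = "a - 2" and a = a and k = 8] e E sum a
      by (simp add: f_def)
    also have "\<dots> = ((a - 2) * (a + 1) * (a ^ 10 * (a + 1) ^ 9)) * a ^ 10"
      by (simp only: expand_powers)
    finally have "prod w ?E \<le> (a - 2) * (a + 1) * (a ^ 10 * (a + 1) ^ 9)"
      using a by simp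
    \<comment> \<open>\<open>(a - 2) * (a + 1)\<close> falls short of \<open>(a - 1) * a\<close> by
      exactly 2.\<close>
    also have "\<dots> < (a - 1) * a * (a ^ 10 * (a + 1) ^ 9)"
      using a by (intro mult_strict_right_mono) (auto simp: c)
    also have "\<dots> = (a - 1) * a ^ 11 * (a + 1) ^ 9" by (simp only: expand_powers)
    finally show ?thesis by (simp add: edge_product_def)
  next
    case False
    \<comment> \<open>The sum is now at most \<open>21 * a + 7\<close>, so \<open>k = 7\<close> is
      available.\<close>
    have "edge_product {1..7} w \<le> a ^ 14 * (a + 1) ^ 7"
      using prod_le_of_sum_le[of ?E a 7 w] E sum False a by (simp add: edge_product_def)
    also have "\<dots> = a ^ 3 * (a ^ 11 * (a + 1) ^ 7)" by (simp only: expand_powers)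
    also have "\<dots> < ((a - 1) * (a + 1) ^ 2) * (a ^ 11 * (a + 1) ^ 7)"
      using a by (intro mult_strict_right_mono) (auto simp: c power2_eq_square power3_eq_cube algebra_simps)
    also have "\<dots> = (a - 1) * a ^ 11 * (a + 1) ^ 9"
      by (simp only: expand_powers)
    finally show ?thesis .
  qed
  then show ?thesis using P by simp
qed (use a in auto)

section \<open>Six vertices\<close>

text \<open>The averaging bound allows 6 heavy edges among 15. Two disjoint heavy triangles attain
  it: a 5-set contains one triangle and one edge of the other, hence exactly 4 heavy edges.\<close>

lemma ex_Pi_6:
  assumes a: "a > 0"
  shows "ex_Pi 6 5 (10 * a + 4) = a ^ 9 * (a + 1) ^ 6"
proof (rule antisym)
  show "ex_Pi 6 5 (10 * a + 4) \<le> a ^ 9 * (a + 1) ^ 6"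
    using ex_Pi_le[of 6 a 15] a by (simp add: choose_two)
next
  define A B where "A = {1..3::nat}" and "B = {4..6::nat}"
  have AB: "A \<inter> B = {}" "A \<union> B = {1..6}" "finite A" "finite B" "card A = 3" "card B = 3"
    by (auto simp: A_def B_def)
  let ?w = "bipart_graph A B (a + 1) (a + 1) a"
  note w = bipart_graph[where p = "a + 1" and q = "a + 1" and r = a, OF AB(1)]
  have "sq_graph (A \<union> B) 5 (10 * a + 4) ?w"
  proof (rule sq_graph_bipartition[OF AB(3,4,1) w(1-4)])
    fix i j :: nat assume "i \<le> card A" "j \<le> card B" "i + j = 5"
    then have "i = 2 \<and> j = 3 \<or> i = 3 \<and> j = 2" unfolding AB by linarith
    then show "(i choose 2) * (a + 1) + (j choose 2) * (a + 1) + i * j * a \<le> 10 * a + 4"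
      by (auto simp: choose_two)
  qed
  then have "?w \<in> nsq_graphs 6 5 (10 * a + 4)" by (simp add: nsq_graphs_def AB)
  moreover have "edge_product {1..6} ?w = a ^ 9 * (a + 1) ^ 6"
    using prod_nsets_2_Un[where w = ?w, OF AB(3,4,1) w(2,3,4)] unfolding AB
    by (simp add: edge_product_def choose_two flip: power_add)
  ultimately show "a ^ 9 * (a + 1) ^ 6 \<le> ex_Pi 6 5 (10 * a + 4)"
    using edge_product_le_ex_Pi[of 6 a ?w] a by simp
qed

lemma turan_weight_6:
  "turan_weight a 6 0 = a ^ 15"
  "turan_weight a 6 1 = a ^ 10 * (a + 1) ^ 5"
  "turan_weight a 6 2 = (a - 2) * a ^ 6 * (a + 1) ^ 8"
  "turan_weight a 6 3 = (a - 2) ^ 3 * a ^ 3 * (a + 1) ^ 9"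
  "turan_weight a 6 4 = (a - 2) ^ 6 * a * (a + 1) ^ 8"
  "turan_weight a 6 5 = (a - 2) ^ 10 * (a + 1) ^ 5"
  "turan_weight a 6 6 = (a - 2) ^ 15"
  by (simp_all add: turan_weight_def choose_two)

text \<open>Sizes 0, 5 and 6 of \<open>V_0\<close> are dominated by size 1, sizes 3 and 4 by size
  2.\<close>

lemma turan_weight_6_le:
  assumes a: "a \<ge> 2" and k: "k \<le> 6"
  shows "turan_weight a 6 k \<le> max (turan_weight a 6 1) (turan_weight a 6 2)"
proof -
  obtain c where c: "a = c + 2" using a by (metis add.commute le_Suc_ex)
  have pow: "(a - 2) ^ i \<le> a ^ i" "a ^ i \<le> (a + 1) ^ i" for i
    by (auto intro: power_mono)
  from k consider "k = 0" | "k = 1" | "k = 2" | "k = 3" | "k = 4" | "k = 5" | "k = 6" by linarith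
  then show ?thesis
  proof cases
    case 1
    have "turan_weight a 6 k = a ^ 10 * a ^ 5" unfolding 1 turan_weight_6 by (simp only: expand_powers)
    also have "\<dots> \<le> turan_weight a 6 1" unfolding turan_weight_6 by (intro mult_left_mono pow) auto
    finally show ?thesis by simp
  next
    case 4
    have "turan_weight a 6 k = ((a - 2) ^ 2 * (a + 1)) * ((a - 2) * a ^ 3 * (a + 1) ^ 8)"
      unfolding 4 turan_weight_6 by (simp only: expand_powers)
    \<comment> \<open>Over the integers,
      \<open>(a - 2) ^ 2 * (a + 1) = a ^ 3 - 3 * a ^ 2 + 4\<close>.\<close>
    also have "\<dots> \<le> a ^ 3 * ((a - 2) * a ^ 3 * (a + 1) ^ 8)"
      by (intro mult_right_mono) (auto simp: c power2_eq_square power3_eq_cube algebra_simps)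
    also have "\<dots> = turan_weight a 6 2" unfolding turan_weight_6 by (simp only: expand_powers)
    finally show ?thesis by simp
  next
    case 5
    have "turan_weight a 6 k = (a - 2) ^ 5 * ((a - 2) * a * (a + 1) ^ 8)"
      unfolding 5 turan_weight_6 by (simp only: expand_powers)
    also have "\<dots> \<le> a ^ 5 * ((a - 2) * a * (a + 1) ^ 8)"
      by (intro mult_right_mono pow) auto
    also have "\<dots> = turan_weight a 6 2" unfolding turan_weight_6 by (simp only: expand_powers)
    finally show ?thesis by simp
  next
    case 6
    have "turan_weight a 6 k = (a - 2) ^ 10 * (a + 1) ^ 5"
      unfolding 6 turan_weight_6 ..
    also have "\<dots> \<le> turan_weight a 6 1" unfolding turan_weight_6 by (intro mult_right_mono pow) auto
    finally show ?thesis by simp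
  next
    case 7
    have "turan_weight a 6 k = (a - 2) ^ 10 * (a - 2) ^ 5"
      unfolding 7 turan_weight_6 by (simp only: expand_powers)
    also have "\<dots> \<le> turan_weight a 6 1"
      unfolding turan_weight_6 by (intro mult_mono pow order_trans[OF pow(1) pow(2)]) auto
    finally show ?thesis by simp
  qed auto
qed

lemma turan_Pi_6:
  assumes a: "a \<ge> 3"
  shows "turan_Pi 2 2 a 6 =
    (if a = 3 \<or> a = 4 then (a + 1) ^ 5 * a ^ 10 else (a - 2) * (a + 1) ^ 8 * a ^ 6)"
    and "turan_Pi 2 2 a 6 < a ^ 9 * (a + 1) ^ 6"
proof -
  obtain c where c: "a = c + 2" "c \<ge> 1" using a by (intro that[of "a - 2"]) auto
  have "turan_Pi 2 2 a 6 \<le> max (turan_weight a 6 1) (turan_weight a 6 2)"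
    unfolding turan_Pi_eq using turan_weight_6_le a by (subst Max_le_iff) auto
  moreover have "max (turan_weight a 6 1) (turan_weight a 6 2) \<le> turan_Pi 2 2 a 6"
    by (intro max.boundedI turan_weight_le_turan_Pi) auto
  ultimately have T: "turan_Pi 2 2 a 6 = max (turan_weight a 6 1) (turan_weight a 6 2)"
    by (rule antisym)
  show "turan_Pi 2 2 a 6 =
    (if a = 3 \<or> a = 4 then (a + 1) ^ 5 * a ^ 10 else (a - 2) * (a + 1) ^ 8 * a ^ 6)"
  \<comment> \<open>After cancelling \<open>a ^ 6 * (a + 1) ^ 5\<close>, sizes 1 and 2 compare as
    \<open>a ^ 4\<close> with \<open>(a - 2) * (a + 1) ^ 3\<close>: 81 > 64, 256 > 250, but 625 <
    648. The substitution \<open>a = d + 5\<close> proves the inequality from 5 on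
    coefficientwise.\<close>
  proof (cases "a = 3 \<or> a = 4")
    case True
    then show ?thesis unfolding T turan_weight_6 by auto
  next
    case False
    then obtain d where d: "a = d + 5" using a by (intro that[of "a - 5"]) auto
    have "a ^ 4 \<le> (a - 2) * (a + 1) ^ 3"
      by (simp add: d power4_eq_xxxx power3_eq_cube algebra_simps)
    note * = mult_right_mono[OF this, of "a ^ 6 * (a + 1) ^ 5"]
    have "turan_weight a 6 1 = a ^ 4 * (a ^ 6 * (a + 1) ^ 5)"
      unfolding turan_weight_6 by (simp only: expand_powers)
    also have "\<dots> \<le> ((a - 2) * (a + 1) ^ 3) * (a ^ 6 * (a + 1) ^ 5)"
      by (rule *) simp
    also have "\<dots> = turan_weight a 6 2" unfolding turan_weight_6 by (simp only: expand_powers)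
    finally show ?thesis unfolding T using False by (simp add: turan_weight_6 mult_ac)
  qed
  have "turan_weight a 6 1 < a ^ 9 * (a + 1) ^ 6"
  proof -
    have "turan_weight a 6 1 = a * (a ^ 9 * (a + 1) ^ 5)"
      unfolding turan_weight_6 by (simp only: expand_powers)
    also have "\<dots> < (a + 1) * (a ^ 9 * (a + 1) ^ 5)"
      using a by (intro mult_strict_right_mono) auto
    also have "\<dots> = a ^ 9 * (a + 1) ^ 6" by (simp only: expand_powers)
    finally show ?thesis .
  qed
  moreover have "turan_weight a 6 2 < a ^ 9 * (a + 1) ^ 6"
  proof -
    have "turan_weight a 6 2 = ((a - 2) * (a + 1) ^ 2) * (a ^ 6 * (a + 1) ^ 6)"
      unfolding turan_weight_6 by (simp only: expand_powers)
    \<comment> \<open>\<open>(a - 2) * (a + 1) ^ 2\<close> is smaller than \<open>a ^ 3\<close> by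
      \<open>3 * a + 2\<close>.\<close>
    also have "\<dots> < a ^ 3 * (a ^ 6 * (a + 1) ^ 6)"
      using a by (intro mult_strict_right_mono) (auto simp: c power2_eq_square power3_eq_cube algebra_simps)
    also have "\<dots> = a ^ 9 * (a + 1) ^ 6" by (simp only: expand_powers)
    finally show ?thesis .
  qed
  ultimately show "turan_Pi 2 2 a 6 < a ^ 9 * (a + 1) ^ 6" unfolding T by simp
qed

section \<open>Five vertices\<close>

text \<open>The averaging bound allows 4 heavy edges among 10, and a single vertex in
  \<open>V_0\<close> gives a heavy star with exactly 4 edges, so the bounds on both quantities
  coincide.\<close>

lemma ex_Pi_5:
  assumes a: "a \<ge> 2"
  shows "ex_Pi 5 5 (10 * a + 4) = (a + 1) ^ 4 * a ^ 6" "turan_Pi 2 2 a 5 = (a + 1) ^ 4 * a ^ 6"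
proof -
  have "(a + 1) ^ 4 * a ^ 6 \<le> turan_Pi 2 2 a 5"
    using turan_weight_le_turan_Pi[of 1 5 a] by (simp add: turan_weight_def choose_two mult_ac)
  moreover have "turan_Pi 2 2 a 5 \<le> ex_Pi 5 5 (10 * a + 4)"
    using a by (intro turan_Pi_le_ex_Pi) auto
  moreover have "ex_Pi 5 5 (10 * a + 4) \<le> (a + 1) ^ 4 * a ^ 6"
    using ex_Pi_le[of 5 a 10] a by (simp add: choose_two mult_ac)
  ultimately show "ex_Pi 5 5 (10 * a + 4) = (a + 1) ^ 4 * a ^ 6" "turan_Pi 2 2 a 5 = (a + 1) ^ 4 * a ^ 6"
    by linarith+
qed

theorem theorem1p1:
  shows "(\<forall>n\<ge>8. (\<lambda>a. real (ex_Pi n 5 (10 * a + 4)) / real (turan_Pi 2 2 a n)) \<longlonglongrightarrow> 1)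
    \<and> (\<forall>a\<ge>3. (a - 2) * (a + 1) ^ 10 * a ^ 10 \<le> ex_Pi 7 5 (10 * a + 4)
           \<and> ex_Pi 7 5 (10 * a + 4) < (a - 1) * a ^ 11 * (a + 1) ^ 9)
    \<and> (\<lambda>a. real (ex_Pi 7 5 (10 * a + 4)) / real (turan_Pi 2 2 a 7)) \<longlonglongrightarrow> 1
    \<and> (\<forall>a\<ge>3. ex_Pi 6 5 (10 * a + 4) = a ^ 9 * (a + 1) ^ 6
           \<and> a ^ 9 * (a + 1) ^ 6 > turan_Pi 2 2 a 6
           \<and> turan_Pi 2 2 a 6 =
               (if a = 3 \<or> a = 4 then (a + 1) ^ 5 * a ^ 10 else (a - 2) * (a + 1) ^ 8 * a ^ 6))
    \<and> (\<forall>a\<ge>3. ex_Pi 5 5 (10 * a + 4) = turan_Pi 2 2 a 5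
           \<and> turan_Pi 2 2 a 5 = (a + 1) ^ 4 * a ^ 6)"
proof (intro conjI allI impI)
  fix n :: nat assume "n \<ge> 8"
  then show "(\<lambda>a. real (ex_Pi n 5 (10 * a + 4)) / real (turan_Pi 2 2 a n)) \<longlonglongrightarrow> 1"
    by (intro ratio_tendsto_1) simp
next
  show "(\<lambda>a. real (ex_Pi 7 5 (10 * a + 4)) / real (turan_Pi 2 2 a 7)) \<longlonglongrightarrow> 1"
    by (rule ratio_tendsto_1) simp
next
  fix a :: nat assume a: "a \<ge> 3"
  show "(a - 2) * (a + 1) ^ 10 * a ^ 10 \<le> ex_Pi 7 5 (10 * a + 4)"
    using a by (intro ex_Pi_7_ge) simp
  show "ex_Pi 7 5 (10 * a + 4) < (a - 1) * a ^ 11 * (a + 1) ^ 9"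
    using a by (rule ex_Pi_7_less)
  show "ex_Pi 6 5 (10 * a + 4) = a ^ 9 * (a + 1) ^ 6"
    using a by (intro ex_Pi_6) simp
  show "a ^ 9 * (a + 1) ^ 6 > turan_Pi 2 2 a 6"
    using a by (rule turan_Pi_6)
  show "turan_Pi 2 2 a 6 =
      (if a = 3 \<or> a = 4 then (a + 1) ^ 5 * a ^ 10 else (a - 2) * (a + 1) ^ 8 * a ^ 6)"
    using a by (rule turan_Pi_6)
  show "turan_Pi 2 2 a 5 = (a + 1) ^ 4 * a ^ 6"
    using a by (intro ex_Pi_5) simp
  then show "ex_Pi 5 5 (10 * a + 4) = turan_Pi 2 2 a 5"
    using a ex_Pi_5(1)[of a] by simp
qed

end
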